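(* There are only finitely many Nielsen equivalence classes of generating pairs of the mapping class group $\mathcal{M}_1\cong \mathrm{SL}(2,\mathbb{Z})$.
   Context: $\mathcal{M}_1$ denotes the mapping class group of a closed oriented surface of genus $1$, i.e. the group of isotopy classes of its orientation-preserving homeomorphisms; it is isomorphic to $\mathrm{SL}(2,\mathbb{Z})$. A generating pair of a group $G$ is a pair $(x_1,x_2)$ of elements of $G$ such that $x_1,x_2$ generate $G$. An elementary Nielsen transformation on a $k$-tuple $(x_1,\ldots,x_k)$ of elements of $G$ is one of the following operations: (1) replace $x_i$ by $x_i^{-1}$ for some $i$; (2) swap $x_i$ and $x_j$ for some $i\neq j$; (3) replace $x_i$ by $x_ix_j$ for some $i\neq j$. Two $k$-tuples are Nielsen equivalent if one can be transformed into the other by a finite sequence of elementary Nielsen transformations. *)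

theory Defs
  imports "HOL-Analysis.Analysis" "HOL-Homology.Homology" "HOL-Algebra.Algebra"
begin

section \<open>Nielsen equivalence\<close>

text \<open>A \<open>k\<close>-tuple of elements of a group is a list of length \<open>k\<close>.\<close>

definition generating_tuples :: "('a, 'b) monoid_scheme \<Rightarrow> nat \<Rightarrow> 'a list set" where
  "generating_tuples G k =
     {xs. length xs = k \<and> set xs \<subseteq> carrier G \<and> generate G (set xs) = carrier G}"

inductive elementary_nielsen :: "('a, 'b) monoid_scheme \<Rightarrow> 'a list \<Rightarrow> 'a list \<Rightarrow> bool"
  for G (structure) where
  invert: "i < length xs \<Longrightarrow> elementary_nielsen G xs (xs[i := inv (xs ! i)])"
| swap: "i < length xs \<Longrightarrow> j < length xs \<Longrightarrow> i \<noteq> j \<Longrightarrow>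
    elementary_nielsen G xs (xs[i := xs ! j, j := xs ! i])"
| multiply: "i < length xs \<Longrightarrow> j < length xs \<Longrightarrow> i \<noteq> j \<Longrightarrow>
    elementary_nielsen G xs (xs[i := xs ! i \<otimes> xs ! j])"

definition nielsen_equivalent :: "('a, 'b) monoid_scheme \<Rightarrow> 'a list \<Rightarrow> 'a list \<Rightarrow> bool" where
  "nielsen_equivalent G = (elementary_nielsen G)\<^sup>*\<^sup>*"

definition nielsen_classes :: "('a, 'b) monoid_scheme \<Rightarrow> nat \<Rightarrow> 'a list set set" where
  "nielsen_classes G k =
     generating_tuples G k //
       {(xs, ys). xs \<in> generating_tuples G k \<and> ys \<in> generating_tuples G k \<and>
                  nielsen_equivalent G xs ys}"

section \<open>The group of integral two by two matrices of determinant one\<close>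

definition SL2Z :: "(int ^ 2 ^ 2) monoid" where
  "SL2Z = \<lparr>carrier = {A. det A = 1}, mult = (**), one = mat 1\<rparr>"

section \<open>The mapping class group of a closed oriented surface of genus one\<close>

definition torus :: "(complex \<times> complex) topology" where
  "torus = top_of_set (sphere 0 1 \<times> sphere 0 1)"

text \<open>For a closed connected oriented surface \<open>S\<close>, the group \<open>H\<^sub>2(S)\<close> is infinite cyclic, and an
  orientation is a choice of generator. A homeomorphism preserves it iff it fixes that
  generator, that is, iff it acts as the identity on \<open>H\<^sub>2(S)\<close>; hence no orientation has to be
  chosen. As in the library's group of bijections of a set, homeomorphisms are normalised to be
  undefined off the underlying set, so that each one is represented by a single function.\<close>

definition orientation_preserving_homeos :: "'a topology \<Rightarrow> ('a \<Rightarrow> 'a) set" where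
  "orientation_preserving_homeos S =
     {f \<in> extensional (topspace S). homeomorphic_map S S f \<and>
        (\<forall>c \<in> carrier (homology_group 2 S). hom_induced 2 S {} S {} f c = c)}"

definition isotopic :: "'a topology \<Rightarrow> ('a \<Rightarrow> 'a) \<Rightarrow> ('a \<Rightarrow> 'a) \<Rightarrow> bool" where
  "isotopic S = homotopic_with (homeomorphic_map S S) S S"

definition isotopy_rel :: "'a topology \<Rightarrow> (('a \<Rightarrow> 'a) \<times> ('a \<Rightarrow> 'a)) set" where
  "isotopy_rel S =
     {(f, g). f \<in> orientation_preserving_homeos S \<and> g \<in> orientation_preserving_homeos S \<and>
              isotopic S f g}"

text \<open>The elementwise product of two isotopy classes is again an isotopy class, namely the one
  of the composition of any two representatives (see \<open>mult_isotopy_class\<close> below).\<close>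

definition mapping_class_group :: "'a topology \<Rightarrow> ('a \<Rightarrow> 'a) set monoid" where
  "mapping_class_group S =
     \<lparr>carrier = orientation_preserving_homeos S // isotopy_rel S,
      mult = (\<lambda>A B. {compose (topspace S) f g | f g. f \<in> A \<and> g \<in> B}),
      one = isotopy_rel S `` {\<lambda>x \<in> topspace S. x}\<rparr>"

section \<open>Well-definedness\<close>

lemma SL2Z_group: "group SL2Z"
proof (rule groupI)
  show "\<exists>B\<in>carrier SL2Z. B \<otimes>\<^bsub>SL2Z\<^esub> A = \<one>\<^bsub>SL2Z\<^esub>" if "A \<in> carrier SL2Z" for A
  proof -
    define B :: "int^2^2" where
      "B = (\<chi> i j. if i = 1 then (if j = 1 then A$2$2 else - A$1$2)
                   else (if j = 1 then - A$2$1 else A$1$1))"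
    have "det B = 1" "B ** A = mat 1"
      using that
      by (auto simp: B_def SL2Z_def det_2 matrix_matrix_mult_def mat_def vec_eq_iff forall_2 sum_2
          algebra_simps)
    then show ?thesis
      by (auto simp: SL2Z_def)
  qed
qed (auto simp: SL2Z_def det_mul matrix_mul_assoc)

context
  fixes S :: "'a topology"
begin

lemma oph_Bij: "f \<in> orientation_preserving_homeos S \<Longrightarrow> f \<in> Bij (topspace S)"
  by (auto simp: orientation_preserving_homeos_def Bij_def bij_betw_def
      homeomorphic_map_def quotient_map_def)

lemma oph_cong:
  assumes "homeomorphic_map S S f" "\<And>x. x \<in> topspace S \<Longrightarrow> f x = g x"
  shows "homeomorphic_map S S g"
  using assms homeomorphic_map_eq by blast

lemma oph_compose: "compose (topspace S) f g \<in> orientation_preserving_homeos S"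
  if f: "f \<in> orientation_preserving_homeos S" and g: "g \<in> orientation_preserving_homeos S"
proof -
  have hm: "homeomorphic_map S S f" "homeomorphic_map S S g"
    using f g by (auto simp: orientation_preserving_homeos_def)
  have "homeomorphic_map S S (f \<circ> g)"
    using hm homeomorphic_map_compose by blast
  then have 1: "homeomorphic_map S S (compose (topspace S) f g)"
    by (rule oph_cong) (simp add: compose_def)
  have "hom_induced 2 S {} S {} (compose (topspace S) f g) = hom_induced 2 S {} S {} (f \<circ> g)"
    by (rule hom_induced_eq) (auto simp: compose_def)
  also have "\<dots> = hom_induced 2 S {} S {} f \<circ> hom_induced 2 S {} S {} g"
    by (rule hom_induced_compose) (use hm in \<open>auto simp: homeomorphic_imp_continuous_map\<close>)
  finally show ?thesis
    using 1 f g by (auto simp: orientation_preserving_homeos_def)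
qed

lemma oph_id: "(\<lambda>x\<in>topspace S. x) \<in> orientation_preserving_homeos S"
proof -
  have "homeomorphic_map S S (\<lambda>x\<in>topspace S. x)"
    by (rule oph_cong[of id]) auto
  moreover have "hom_induced 2 S {} S {} (\<lambda>x\<in>topspace S. x) c = c"
    if "c \<in> carrier (homology_group 2 S)" for c
    by (rule hom_induced_id_gen) (use that in \<open>auto intro: continuous_map_eq[of _ _ id]\<close>)
  ultimately show ?thesis
    by (auto simp: orientation_preserving_homeos_def)
qed

lemma oph_inverse: "\<exists>g\<in>orientation_preserving_homeos S. compose (topspace S) g f = (\<lambda>x\<in>topspace S. x) \<and>
    compose (topspace S) f g = (\<lambda>x\<in>topspace S. x)"
  if f: "f \<in> orientation_preserving_homeos S"
proof -
  have hf: "homeomorphic_map S S f"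
    using f by (auto simp: orientation_preserving_homeos_def)
  then obtain g' where g': "homeomorphic_maps S S f g'"
    using homeomorphic_map_maps by blast
  define g where "g = restrict g' (topspace S)"
  have hg': "homeomorphic_map S S g'"
    using g' homeomorphic_map_maps homeomorphic_maps_sym by blast
  have hg: "homeomorphic_map S S g"
    by (rule oph_cong[OF hg']) (simp add: g_def)
  have top: "f x \<in> topspace S" "g x \<in> topspace S" if "x \<in> topspace S" for x
    using hf hg that by (auto simp: homeomorphic_map_def quotient_map_def)
  have gf: "compose (topspace S) g f = (\<lambda>x\<in>topspace S. x)"
    "compose (topspace S) f g = (\<lambda>x\<in>topspace S. x)"
    using g' top by (auto simp: compose_def homeomorphic_maps_def g_def fun_eq_iff)
  have "hom_induced 2 S {} S {} g c = c" if c: "c \<in> carrier (homology_group 2 S)" for c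
  proof -
    have "hom_induced 2 S {} S {} (g \<circ> f) c = hom_induced 2 S {} S {} g (hom_induced 2 S {} S {} f c)"
      by (subst hom_induced_compose[of S S f "{}" "{}" S g])
        (use hf hg in \<open>auto simp: homeomorphic_imp_continuous_map\<close>)
    moreover have "hom_induced 2 S {} S {} (g \<circ> f) c = c"
    proof (rule hom_induced_id_gen)
      show "continuous_map S S (g \<circ> f)"
        using hf hg homeomorphic_imp_continuous_map continuous_map_compose by blast
      show "(g \<circ> f) x = x" if "x \<in> topspace S" for x
        using fun_cong[OF gf(1), of x] that by (simp add: compose_def)
    qed (use c in auto)
    ultimately show ?thesis
      using f c by (auto simp: orientation_preserving_homeos_def)
  qed
  then have "g \<in> orientation_preserving_homeos S"
    using hg by (auto simp: orientation_preserving_homeos_def g_def)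
  with gf show ?thesis by blast
qed

lemma equiv_isotopy_rel: "equiv (orientation_preserving_homeos S) (isotopy_rel S)"
proof (rule equivI)
  show "refl_on (orientation_preserving_homeos S) (isotopy_rel S)"
    by (auto simp: refl_on_def isotopy_rel_def isotopic_def orientation_preserving_homeos_def
        homeomorphic_imp_continuous_map)
  show "sym (isotopy_rel S)"
    by (auto simp: sym_def isotopy_rel_def isotopic_def homotopic_with_sym)
  show "trans (isotopy_rel S)"
    by (auto simp: trans_def isotopy_rel_def isotopic_def intro: homotopic_with_trans)
qed (auto simp: isotopy_rel_def)

lemma isotopic_compose:
  assumes "isotopic S f f'" "isotopic S g g'"
  shows "isotopic S (compose (topspace S) f g) (compose (topspace S) f' g')"
proof -
  obtain h where h: "continuous_map (prod_topology (top_of_set {0..1::real}) S) S h"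
      "\<And>x. h (0, x) = f x" "\<And>x. h (1, x) = f' x"
      "\<And>t. t \<in> {0..1} \<Longrightarrow> homeomorphic_map S S (\<lambda>x. h (t, x))"
    using assms(1) by (auto simp: isotopic_def homotopic_with_def)
  obtain k where k: "continuous_map (prod_topology (top_of_set {0..1::real}) S) S k"
      "\<And>x. k (0, x) = g x" "\<And>x. k (1, x) = g' x"
      "\<And>t. t \<in> {0..1} \<Longrightarrow> homeomorphic_map S S (\<lambda>x. k (t, x))"
    using assms(2) by (auto simp: isotopic_def homotopic_with_def)
  let ?l = "\<lambda>(t, x). compose (topspace S) (\<lambda>y. h (t, y)) (\<lambda>y. k (t, y)) x"
  have "continuous_map (prod_topology (top_of_set {0..1::real}) S) S (h \<circ> (\<lambda>p. (fst p, k p)))"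
    by (rule continuous_map_compose[OF _ h(1)])
      (simp add: continuous_map_pairedI continuous_map_fst k(1))
  then have "continuous_map (prod_topology (top_of_set {0..1::real}) S) S ?l"
    by (rule continuous_map_eq) (auto simp: compose_def)
  moreover have "homeomorphic_map S S (\<lambda>x. ?l (t, x))" if "t \<in> {0..1}" for t
    by (rule oph_cong[OF homeomorphic_map_compose[OF k(4) h(4)]]) (use that in \<open>auto simp: compose_def\<close>)
  moreover have "?l (0, x) = compose (topspace S) f g x" "?l (1, x) = compose (topspace S) f' g' x" for x
    by (auto simp: compose_def h k)
  ultimately show ?thesis
    unfolding isotopic_def homotopic_with_def by blast
qed

lemma mult_isotopy_class:
  assumes f: "f \<in> orientation_preserving_homeos S" and g: "g \<in> orientation_preserving_homeos S"
  shows "isotopy_rel S `` {f} \<otimes>\<^bsub>mapping_class_group S\<^esub> isotopy_rel S `` {g} =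
         isotopy_rel S `` {compose (topspace S) f g}" (is "?L = ?R")
proof
  show "?L \<subseteq> ?R"
    using f g by (auto simp: mapping_class_group_def isotopy_rel_def oph_compose isotopic_compose)
  show "?R \<subseteq> ?L"
  proof
    fix k assume "k \<in> ?R"
    then have k: "k \<in> orientation_preserving_homeos S" "isotopic S (compose (topspace S) f g) k"
      by (auto simp: isotopy_rel_def)
    obtain f' where f': "f' \<in> orientation_preserving_homeos S"
      "compose (topspace S) f' f = (\<lambda>x\<in>topspace S. x)" "compose (topspace S) f f' = (\<lambda>x\<in>topspace S. x)"
      using oph_inverse[OF f] by blast
    have refl: "isotopic S a a" if "a \<in> orientation_preserving_homeos S" for a
      using equiv_isotopy_rel that unfolding equiv_def refl_on_def isotopy_rel_def by blast
    have func: "a \<in> topspace S \<rightarrow> topspace S" "a \<in> extensional (topspace S)"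
      if "a \<in> orientation_preserving_homeos S" for a
      using oph_Bij[OF that] by (auto simp: Bij_imp_funcset Bij_imp_extensional)
    have assoc: "compose (topspace S) (compose (topspace S) a b) c = compose (topspace S) a (compose (topspace S) b c)"
      if "a \<in> orientation_preserving_homeos S" "b \<in> orientation_preserving_homeos S" "c \<in> orientation_preserving_homeos S" for a b c
      using compose_assoc[of c "topspace S" "topspace S" a b] func that by metis
    have "isotopic S (compose (topspace S) f' (compose (topspace S) f g)) (compose (topspace S) f' k)"
      by (intro isotopic_compose refl f' k)
    moreover have "compose (topspace S) f' (compose (topspace S) f g) = g"
      using assoc[OF f'(1) f g] f'(2) func[OF g] by simp
    ultimately have "compose (topspace S) f' k \<in> isotopy_rel S `` {g}"
      using g f' k by (simp add: isotopy_rel_def oph_compose)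
    moreover have "compose (topspace S) f (compose (topspace S) f' k) = k"
      using assoc[OF f f'(1) k(1)] f'(3) func[OF k(1)] by simp
    moreover have "f \<in> isotopy_rel S `` {f}"
      using f refl by (simp add: isotopy_rel_def)
    ultimately show "k \<in> ?L"
      by (auto simp: mapping_class_group_def) metis
  qed
qed

lemma mapping_class_group_group: "group (mapping_class_group S)"
proof -
  let ?c = "\<lambda>f. isotopy_rel S `` {f}"
  have func: "a \<in> topspace S \<rightarrow> topspace S" "a \<in> extensional (topspace S)"
    if "a \<in> orientation_preserving_homeos S" for a
    using oph_Bij[OF that] by (auto simp: Bij_imp_funcset Bij_imp_extensional)
  have assoc: "compose (topspace S) (compose (topspace S) a b) c = compose (topspace S) a (compose (topspace S) b c)"
    if "a \<in> orientation_preserving_homeos S" "b \<in> orientation_preserving_homeos S" "c \<in> orientation_preserving_homeos S" for a b c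
    using compose_assoc[of c "topspace S" "topspace S" a b] func that by metis
  have carrier: "carrier (mapping_class_group S) = ?c ` orientation_preserving_homeos S"
    by (auto simp: mapping_class_group_def quotient_def)
  have one: "\<one>\<^bsub>mapping_class_group S\<^esub> = ?c (\<lambda>x\<in>topspace S. x)"
    by (simp add: mapping_class_group_def)
  show ?thesis
  proof (rule groupI)
    show "\<exists>y\<in>carrier (mapping_class_group S).
        y \<otimes>\<^bsub>mapping_class_group S\<^esub> x = \<one>\<^bsub>mapping_class_group S\<^esub>"
      if x: "x \<in> carrier (mapping_class_group S)" for x
    proof -
      obtain f where f: "f \<in> orientation_preserving_homeos S" "x = ?c f" using x carrier by auto
      obtain g where g: "g \<in> orientation_preserving_homeos S"
        "compose (topspace S) g f = (\<lambda>x\<in>topspace S. x)"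
        using oph_inverse[OF f(1)] by blast
      then show ?thesis
        using f by (auto simp: carrier one mult_isotopy_class intro!: bexI[of _ g])
    qed
  qed (auto simp: carrier one mult_isotopy_class oph_compose oph_id assoc func)
qed

end

end

(* If A and B generate SL(2,Z), then the integral span of 1, A, B, AB is a ring containing
   SL(2,Z), hence all of M_2(Z). The discriminant of this order is, up to sign, tr[A,B] - 2, so the
   traces x, y, z of A, B, AB satisfy the Markov-type equation x^2 + y^2 + z^2 - xyz = 4 + 1 or
   4 - 1. Nielsen moves act on (x, y, z) by Markov moves, and a solution minimising
   |x| + |y| + |z| has a zero coordinate, so A may be assumed to have trace 0. Simultaneous
   conjugation by the generated group is a Nielsen equivalence; a conjugate of A with minimal
   corner entry is plus or minus the rotation of order 4, and then the equation bounds B. *)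
theory Submission
  imports Defs
begin

section \<open>Nielsen equivalence in an arbitrary group\<close>

context group
begin

lemma elementary_nielsen_carrier:
  assumes "elementary_nielsen G xs ys" "set xs \<subseteq> carrier G"
  shows "set ys \<subseteq> carrier G"
proof -
  have "xs ! i \<in> carrier G" if "i < length xs" for i
    using assms(2) that nth_mem by blast
  with assms(1) show ?thesis
    using assms(2)
    by (elim elementary_nielsen.cases) (auto dest!: set_update_subset_insert[THEN subsetD])
qed

lemma nielsen_equivalent_carrier:
  assumes "nielsen_equivalent G xs ys" "set xs \<subseteq> carrier G"
  shows "set ys \<subseteq> carrier G"
  using assms unfolding nielsen_equivalent_def
  by (induction rule: rtranclp_induct) (auto dest: elementary_nielsen_carrier)

lemma nielsen_equivalent_length:
  assumes "nielsen_equivalent G xs ys"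
  shows "length ys = length xs"
  using assms unfolding nielsen_equivalent_def
  by (induction rule: rtranclp_induct) (auto elim: elementary_nielsen.cases)

lemma nielsen_equivalent_refl: "nielsen_equivalent G xs xs"
  by (simp add: nielsen_equivalent_def)

lemma nielsen_equivalent_trans [trans]:
  "nielsen_equivalent G xs ys \<Longrightarrow> nielsen_equivalent G ys zs \<Longrightarrow> nielsen_equivalent G xs zs"
  by (simp add: nielsen_equivalent_def)

lemma elementary_nielsen_imp_equivalent:
  "elementary_nielsen G xs ys \<Longrightarrow> nielsen_equivalent G xs ys"
  by (simp add: nielsen_equivalent_def r_into_rtranclp)

text \<open>Inversions and swaps are involutions; a multiplication by entry \<open>j\<close> is
  undone by inverting that entry, multiplying again and inverting it back.\<close>

lemma elementary_nielsen_sym: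
  assumes "elementary_nielsen G xs ys" "set xs \<subseteq> carrier G"
  shows "nielsen_equivalent G ys xs"
proof -
  have car: "xs ! i \<in> carrier G" if "i < length xs" for i
    using assms(2) that nth_mem by blast
  show ?thesis
    using assms(1)
  proof cases
    case (invert i)
    have "xs = ys[i := inv (ys ! i)]"
      using invert car by simp
    then show ?thesis
      using elementary_nielsen.invert[of i ys G] invert
      by (metis elementary_nielsen_imp_equivalent length_list_update)
  next
    case (swap i j)
    have "xs = ys[i := ys ! j, j := ys ! i]"
      using swap by (simp add: list_update_swap)
    then show ?thesis
      using elementary_nielsen.swap[of i ys j G] swap
      by (metis elementary_nielsen_imp_equivalent length_list_update)
  next
    case (multiply i j)
    have c: "xs ! i \<in> carrier G" "xs ! j \<in> carrier G"
      using car multiply by auto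
    have 1: "elementary_nielsen G ys (ys[j := inv (xs ! j)])"
      using elementary_nielsen.invert[of j ys G] multiply by simp
    let ?us = "ys[j := inv (xs ! j)]"
    have "?us ! i \<otimes> ?us ! j = xs ! i"
      using multiply c by (simp add: m_assoc)
    then have 2: "elementary_nielsen G ?us (?us[i := xs ! i])"
      using elementary_nielsen.multiply[of i ?us j G] multiply by simp
    let ?vs = "?us[i := xs ! i]"
    have "elementary_nielsen G ?vs (?vs[j := inv (?vs ! j)])"
      by (rule elementary_nielsen.invert) (use multiply in simp)
    moreover have "?vs[j := inv (?vs ! j)] = xs"
      using multiply c by (simp add: list_update_swap)
    ultimately show ?thesis
      using 1 2 by (simp add: nielsen_equivalent_def)
  qed
qed

lemma nielsen_equivalent_sym:
  assumes "nielsen_equivalent G xs ys" "set xs \<subseteq> carrier G"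
  shows "nielsen_equivalent G ys xs"
  using assms unfolding nielsen_equivalent_def
proof (induction rule: rtranclp_induct)
  case (step ys zs)
  then have "set ys \<subseteq> carrier G"
    using nielsen_equivalent_carrier nielsen_equivalent_def by metis
  then show ?case
    using elementary_nielsen_sym[OF step.hyps(2)] step
    by (metis nielsen_equivalent_def rtranclp_trans)
qed auto

lemma elementary_nielsen_generate_subset:
  assumes "elementary_nielsen G xs ys"
  shows "set ys \<subseteq> generate G (set xs)"
proof -
  have "xs ! i \<in> generate G (set xs)" "inv (xs ! i) \<in> generate G (set xs)" if "i < length xs" for i
    using that nth_mem by (auto intro: generate.incl generate.inv)
  moreover have "set xs \<subseteq> generate G (set xs)"
    by (auto intro: generate.incl)
  ultimately show ?thesis
    using assms
    by (elim elementary_nielsen.cases) (auto dest!: set_update_subset_insert[THEN subsetD] intro: generate.eng)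
qed

lemma nielsen_equivalent_generate_subset:
  assumes "nielsen_equivalent G xs ys" "set xs \<subseteq> carrier G"
  shows "generate G (set ys) \<subseteq> generate G (set xs)"
  using assms unfolding nielsen_equivalent_def
proof (induction rule: rtranclp_induct)
  case (step ys zs)
  then have "set ys \<subseteq> carrier G"
    using nielsen_equivalent_carrier nielsen_equivalent_def by metis
  then have "generate G (set zs) \<subseteq> generate G (set ys)"
    using elementary_nielsen_generate_subset[OF step.hyps(2)]
    by (simp add: generate_is_subgroup generate_subgroup_incl)
  then show ?case
    using step by blast
qed auto

lemma nielsen_equivalent_generating:
  assumes "nielsen_equivalent G xs ys" "xs \<in> generating_tuples G k"
  shows "ys \<in> generating_tuples G k"
proof -
  have xs: "set xs \<subseteq> carrier G"
    using assms by (auto simp: generating_tuples_def)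
  then have ys: "set ys \<subseteq> carrier G"
    using assms nielsen_equivalent_carrier by blast
  have "generate G (set xs) = generate G (set ys)"
    using nielsen_equivalent_generate_subset assms(1) xs ys nielsen_equivalent_sym by blast
  then show ?thesis
    using assms ys nielsen_equivalent_length by (auto simp: generating_tuples_def)
qed

text \<open>\<open>F\<close> may also contain tuples that do not generate: any tuple equivalent to a
  generating one generates too, so every class is the class of a member of \<open>F\<close>.\<close>

lemma finite_nielsen_classes:
  assumes "finite F"
    and F: "\<And>xs. xs \<in> generating_tuples G k \<Longrightarrow> \<exists>ys\<in>F. nielsen_equivalent G xs ys"
  shows "finite (nielsen_classes G k)"
proof -
  define R where "R = {(xs, ys). xs \<in> generating_tuples G k \<and> ys \<in> generating_tuples G k \<and>
                  nielsen_equivalent G xs ys}"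
  have sym: "nielsen_equivalent G ys xs"
    if "xs \<in> generating_tuples G k" "nielsen_equivalent G xs ys" for xs ys
    using that nielsen_equivalent_sym by (auto simp: generating_tuples_def)
  have "nielsen_classes G k \<subseteq> (\<lambda>ys. R `` {ys}) ` F"
  proof
    fix C assume "C \<in> nielsen_classes G k"
    then obtain xs where xs: "xs \<in> generating_tuples G k" and C: "C = R `` {xs}"
      by (auto simp: nielsen_classes_def R_def[symmetric] elim!: quotientE)
    then obtain ys where ys: "ys \<in> F" "nielsen_equivalent G xs ys"
      using F by blast
    have "ys \<in> generating_tuples G k"
      using nielsen_equivalent_generating ys xs by blast
    then have "C = R `` {ys}"
      using xs ys sym C by (auto simp: R_def intro: nielsen_equivalent_trans)
    then show "C \<in> (\<lambda>ys. R `` {ys}) ` F"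
      using ys by blast
  qed
  then show ?thesis
    using assms(1) finite_surj by blast
qed

lemma nielsen_swap: "nielsen_equivalent G [a, b] [b, a]"
  using elementary_nielsen.swap[of 0 "[a, b]" 1 G] elementary_nielsen_imp_equivalent by simp

lemma nielsen_inv1: "nielsen_equivalent G [a, b] [inv a, b]"
  using elementary_nielsen.invert[of 0 "[a, b]" G] elementary_nielsen_imp_equivalent by simp

lemma nielsen_inv2: "nielsen_equivalent G [a, b] [a, inv b]"
  using elementary_nielsen.invert[of 1 "[a, b]" G] elementary_nielsen_imp_equivalent by simp

lemma nielsen_mult2: "nielsen_equivalent G [a, b] [a, b \<otimes> a]"
  using elementary_nielsen.multiply[of 1 "[a, b]" 0 G] elementary_nielsen_imp_equivalent by simp

text \<open>Elementary moves multiply only on the right; since \<open>a \<otimes> b\<close> is the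
  inverse of \<open>inv b \<otimes> inv a\<close>, a right multiplication between inversions gives a
  left one.\<close>

lemma nielsen_mult2_left:
  assumes "a \<in> carrier G" "b \<in> carrier G"
  shows "nielsen_equivalent G [a, b] [a, a \<otimes> b]"
proof -
  note nielsen_inv1[of a b]
  also note nielsen_inv2[of "inv a" b]
  also note nielsen_mult2[of "inv a" "inv b"]
  also note nielsen_inv1[of "inv a" "inv b \<otimes> inv a"]
  also note nielsen_inv2[of "inv (inv a)" "inv b \<otimes> inv a"]
  finally show ?thesis
    using assms by (simp add: inv_mult_group)
qed

lemma nielsen_conj2:
  assumes "a \<in> carrier G" "b \<in> carrier G"
  shows "nielsen_equivalent G [a, b] [a, a \<otimes> b \<otimes> inv a]"
proof -
  note nielsen_mult2_left[OF assms]
  also note nielsen_inv1[of a "a \<otimes> b"]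
  also note nielsen_mult2[of "inv a" "a \<otimes> b"]
  also note nielsen_inv1[of "inv a" "a \<otimes> b \<otimes> inv a"]
  finally show ?thesis
    using assms by simp
qed

end

section \<open>Homomorphic images and inner automorphisms\<close>

lemma (in group_hom) nielsen_equivalent_map:
  assumes "nielsen_equivalent G xs ys" "set xs \<subseteq> carrier G"
  shows "nielsen_equivalent H (map h xs) (map h ys)"
  using assms unfolding nielsen_equivalent_def
proof (induction rule: rtranclp_induct)
  case (step ys zs)
  then have ys: "set ys \<subseteq> carrier G"
    using G.nielsen_equivalent_carrier nielsen_equivalent_def by metis
  have car: "ys ! i \<in> carrier G" if "i < length ys" for i
    using ys that nth_mem by blast
  have "elementary_nielsen H (map h ys) (map h zs)"
    using step.hyps(2)
  proof cases
    case (invert i)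
    then show ?thesis
      using elementary_nielsen.invert[of i "map h ys" H] car by (simp add: map_update)
  next
    case (swap i j)
    then show ?thesis
      using elementary_nielsen.swap[of i "map h ys" j H] by (simp add: map_update)
  next
    case (multiply i j)
    then show ?thesis
      using elementary_nielsen.multiply[of i "map h ys" j H] car by (simp add: map_update)
  qed
  then show ?case
    using step by (simp add: rtranclp.rtrancl_into_rtrancl)
qed auto

context group
begin

lemma conj_group_hom:
  assumes "g \<in> carrier G"
  shows "group_hom G G (\<lambda>x. g \<otimes> x \<otimes> inv g)"
proof (unfold_locales, rule homI)
  fix x y assume "x \<in> carrier G" "y \<in> carrier G"
  then show "g \<otimes> (x \<otimes> y) \<otimes> inv g = (g \<otimes> x \<otimes> inv g) \<otimes> (g \<otimes> y \<otimes> inv g)"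
    using assms by (simp add: m_assoc inv_solve_left)
qed (use assms in auto)

text \<open>Inner automorphisms of the free group of rank two are products of elementary Nielsen
  transformations.\<close>

lemma nielsen_conj:
  assumes ab: "a \<in> carrier G" "b \<in> carrier G" and g: "g \<in> generate G {a, b}"
  shows "nielsen_equivalent G [a, b] [g \<otimes> a \<otimes> inv g, g \<otimes> b \<otimes> inv g]"
  using g
proof (induction rule: generate.induct)
  case one
  then show ?case using ab by (simp add: nielsen_equivalent_refl)
next
  case (incl h)
  \<comment> \<open>Conjugation by one entry fixes that entry, so only the other one has to be
    conjugated; for \<open>h = b\<close> the entries are swapped before and after.\<close>
  note nielsen_swap[of a b]
  also note nielsen_conj2[OF ab(2,1)]
  also note nielsen_swap
  finally show ?case
    using incl nielsen_conj2[OF ab] ab by (auto simp: m_assoc)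
next
  case (inv h)
  have *: "nielsen_equivalent G [x, y] [x, inv x \<otimes> y \<otimes> x]"
    if "x \<in> carrier G" "y \<in> carrier G" for x y
  proof -
    note nielsen_inv1[of x y]
    also have "nielsen_equivalent G [inv x, y] [inv x, inv x \<otimes> y \<otimes> x]"
      using nielsen_conj2[of "inv x" y] that by simp
    also note nielsen_inv1
    finally show ?thesis
      using that by simp
  qed
  note nielsen_swap[of a b]
  also note *[OF ab(2,1)]
  also note nielsen_swap
  finally show ?case
    using inv *[OF ab] ab by auto
next
  case (eng h1 h2)
  then have h: "h1 \<in> carrier G" "h2 \<in> carrier G"
    using ab generate_in_carrier[of "{a, b}"] by auto
  \<comment> \<open>The moves for \<open>h2\<close>, transported by conjugation with
    \<open>h1\<close>, lead on from the \<open>h1\<close>-conjugate of the pair to its conjugate by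
    \<open>h1 \<otimes> h2\<close>.\<close>
  interpret c: group_hom G G "\<lambda>x. h1 \<otimes> x \<otimes> inv h1"
    using conj_group_hom h by blast
  have "h1 \<otimes> (h2 \<otimes> x \<otimes> inv h2) \<otimes> inv h1 = h1 \<otimes> h2 \<otimes> x \<otimes> inv (h1 \<otimes> h2)"
    if "x \<in> carrier G" for x
    using h that by (simp add: m_assoc inv_mult_group)
  then show ?case
    using c.nielsen_equivalent_map[OF eng.IH(2)] ab eng.IH(1)
    by (auto intro: nielsen_equivalent_trans)
qed

end

lemma generating_tuples_iso:
  assumes "group G" "group H" "h \<in> iso G H" "xs \<in> generating_tuples G k"
  shows "map h xs \<in> generating_tuples H k"
proof -
  interpret group_hom G H h
    using assms by (simp add: group_hom_def group_hom_axioms_def iso_def)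
  have "h ` carrier G = carrier H"
    using assms(3) by (auto simp: iso_def bij_betw_def)
  then show ?thesis
    using assms(4) generate_img[of "set xs"] by (auto simp: generating_tuples_def)
qed

text \<open>A generating tuple of \<open>H\<close> is pulled back to \<open>G\<close>, reduced there
  to a member of \<open>F\<close>, and the moves are pushed forward again.\<close>

lemma finite_nielsen_cover_iso:
  assumes G: "group G" and H: "group H" and iso: "G \<cong> H" and "finite F"
    and F: "\<And>xs. xs \<in> generating_tuples G k \<Longrightarrow> \<exists>ys\<in>F. nielsen_equivalent G xs ys"
  shows "finite (nielsen_classes H k)"
proof -
  obtain h where h: "h \<in> iso G H"
    using iso by (auto simp: is_iso_def)
  define h' where "h' = inv_into (carrier G) h"
  have h': "h' \<in> iso H G"
    unfolding h'_def using group.iso_set_sym[OF G h] .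
  have hh': "h (h' x) = x" if "x \<in> carrier H" for x
    using h that unfolding h'_def iso_def by (auto intro: bij_betw_inv_into_right)
  interpret group_hom G H h
    using G H h by (simp add: group_hom_def group_hom_axioms_def iso_def)
  show ?thesis
  proof (rule H.finite_nielsen_classes)
    show "finite (map h ` F)" using \<open>finite F\<close> by simp
    fix xs assume xs: "xs \<in> generating_tuples H k"
    then have *: "map h' xs \<in> generating_tuples G k"
      using generating_tuples_iso[OF H G h'] by blast
    then obtain ys where ys: "ys \<in> F" "nielsen_equivalent G (map h' xs) ys"
      using F by blast
    have "map h (map h' xs) = xs"
      using xs hh' by (auto simp: generating_tuples_def intro!: map_idI)
    then show "\<exists>ys\<in>map h ` F. nielsen_equivalent H xs ys"
      using nielsen_equivalent_map[OF ys(2)] ys(1) * by (auto simp: generating_tuples_def)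
  qed
qed

section \<open>The Markov-type equation\<close>

text \<open>As a quadratic in \<open>c\<close> the expression is symmetric about
  \<open>a * b / 2\<close>, so for \<open>c\<close> between \<open>b\<close> and that point it is
  largest at \<open>c = b\<close>. For \<open>a \<ge> 3\<close> this bounds it by
  \<open>a^2 * (3 - a) \<le> 0\<close>; \<open>a = 2\<close> forces \<open>c = b\<close> and the
  value 4, and \<open>a = 1\<close> is contradictory.\<close>

lemma markov_sorted:
  fixes a b c :: int
  assumes "1 \<le> a" "a \<le> b" "b \<le> c" "2 * c \<le> a * b"
  shows "a^2 + b^2 + c^2 - a * b * c \<notin> {3, 5}"
proof -
  consider "a = 1" | "a = 2" | "a \<ge> 3" using assms by linarith
  then show ?thesis
  proof cases
    case 3
    have "(c - b) * (c + b - a * b) \<le> 0"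
      using assms by (intro mult_nonneg_nonpos) auto
    moreover have "(a - 2) * a^2 \<le> (a - 2) * b^2"
      using 3 assms by (intro mult_left_mono power_mono) auto
    moreover have "a^2 * (3 - a) \<le> 0"
      using 3 by (intro mult_nonneg_nonpos) auto
    ultimately have "a^2 + b^2 + c^2 - a * b * c \<le> 0"
      by (simp add: algebra_simps power2_eq_square)
    then show ?thesis by auto
  next
    case 2
    then have "c = b" using assms by simp
    then have "a^2 + b^2 + c^2 - a * b * c = 4"
      using 2 by (simp add: power2_eq_square)
    then show ?thesis by simp
  qed (use assms in auto)
qed

lemma markov_positive:
  fixes a b c :: int
  assumes pos: "1 \<le> a" "1 \<le> b" "1 \<le> c"
    and le: "2 * c \<le> a * b" "2 * b \<le> a * c" "2 * a \<le> b * c"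
  shows "a^2 + b^2 + c^2 - a * b * c \<notin> {3, 5}"
proof -
  consider "a \<le> b" "b \<le> c" | "a \<le> c" "c \<le> b" | "b \<le> a" "a \<le> c" | "b \<le> c" "c \<le> a"
    | "c \<le> a" "a \<le> b" | "c \<le> b" "b \<le> a"
    by linarith
  then show ?thesis
  proof cases
    case 1 then show ?thesis using markov_sorted[of a b c] pos le by (simp add: ac_simps)
  next
    case 2 then show ?thesis using markov_sorted[of a c b] pos le by (simp add: ac_simps)
  next
    case 3 then show ?thesis using markov_sorted[of b a c] pos le by (simp add: ac_simps)
  next
    case 4 then show ?thesis using markov_sorted[of b c a] pos le by (simp add: ac_simps)
  next
    case 5 then show ?thesis using markov_sorted[of c a b] pos le by (simp add: ac_simps)
  next
    case 6 then show ?thesis using markov_sorted[of c b a] pos le by (simp add: ac_simps)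
  qed
qed

text \<open>For \<open>p\<close> and \<open>z\<close> of equal sign,
  \<open>\<bar>p - z\<bar>\<close> is the distance of their absolute values, and it is less than
  \<open>\<bar>z\<bar>\<close> unless \<open>\<bar>p\<bar>\<close> is at least twice as
  large.\<close>

lemma abs_diff_ge_imp_double_le:
  fixes p z :: int
  assumes "\<bar>z\<bar> \<le> \<bar>p - z\<bar>" "0 < p * z"
  shows "2 * \<bar>z\<bar> \<le> \<bar>p\<bar>"
  using assms by (auto simp: zero_less_mult_iff)

text \<open>The triple (1, 1, 1) gives 4; any other has a square of at least 4 and so a value above
  5.\<close>

lemma markov_negative:
  fixes a b c :: int
  assumes "1 \<le> a" "1 \<le> b" "1 \<le> c"
  shows "a^2 + b^2 + c^2 + a * b * c \<notin> {3, 5}"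
proof (cases "a = 1 \<and> b = 1 \<and> c = 1")
  case False
  have sq: "n^2 \<ge> 1 \<and> (n \<noteq> 1 \<longrightarrow> n^2 \<ge> 4)" if "n \<ge> 1" for n :: int
    using power_mono[of 1 n 2] power_mono[of 2 n 2] that by auto
  have "1 \<le> a * b * c"
    using mult_pos_pos[of "a * b" c] mult_pos_pos[of a b] assms by linarith
  then have "a^2 + b^2 + c^2 + a * b * c > 5"
    using sq[of a] sq[of b] sq[of c] assms False by linarith
  then show ?thesis by simp
qed simp

text \<open>Each minimality hypothesis compares a coordinate with the other root of the equation,
  read as a quadratic in that coordinate. If no coordinate vanishes, only the sign of
  \<open>x * y * z\<close> survives the passage to absolute values.\<close>

lemma markov_minimal:
  fixes x y z :: int
  assumes eq: "x^2 + y^2 + z^2 - x * y * z \<in> {3, 5}"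
    and min: "\<bar>z\<bar> \<le> \<bar>x * y - z\<bar>" "\<bar>y\<bar> \<le> \<bar>x * z - y\<bar>" "\<bar>x\<bar> \<le> \<bar>y * z - x\<bar>"
  shows "x = 0 \<or> y = 0 \<or> z = 0"
proof (rule ccontr)
  assume "\<not> ?thesis"
  then have nz: "1 \<le> \<bar>x\<bar>" "1 \<le> \<bar>y\<bar>" "1 \<le> \<bar>z\<bar>" "x * y * z \<noteq> 0" by auto
  then consider "x * y * z < 0" | "x * y * z > 0" by linarith
  then show False
  proof cases
    case 1
    then have "\<bar>x\<bar> * \<bar>y\<bar> * \<bar>z\<bar> = - (x * y * z)"
      by (simp flip: abs_mult)
    then show False
      using markov_negative[OF nz(1-3)] eq by auto
  next
    case 2
    then have "\<bar>x\<bar> * \<bar>y\<bar> * \<bar>z\<bar> = x * y * z"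
      by (simp flip: abs_mult)
    moreover have "2 * \<bar>z\<bar> \<le> \<bar>x\<bar> * \<bar>y\<bar>" "2 * \<bar>y\<bar> \<le> \<bar>x\<bar> * \<bar>z\<bar>" "2 * \<bar>x\<bar> \<le> \<bar>y\<bar> * \<bar>z\<bar>"
      using abs_diff_ge_imp_double_le[OF min(1)] abs_diff_ge_imp_double_le[OF min(2)]
        abs_diff_ge_imp_double_le[OF min(3)] 2 by (simp_all add: abs_mult ac_simps)
    ultimately show False
      using markov_positive[OF nz(1-3)] eq by auto
  qed
qed

section \<open>Integral two by two matrices in coordinates\<close>

definition mat2 :: "int \<Rightarrow> int \<Rightarrow> int \<Rightarrow> int \<Rightarrow> int ^ 2 ^ 2" where
  "mat2 a b c d = vector [vector [a, b], vector [c, d]]"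

lemma mat2_nth [simp]:
  "mat2 a b c d $ 1 $ 1 = a" "mat2 a b c d $ 1 $ 2 = b"
  "mat2 a b c d $ 2 $ 1 = c" "mat2 a b c d $ 2 $ 2 = d"
  by (simp_all add: mat2_def)

lemma mat2_eta: "A = mat2 (A$1$1) (A$1$2) (A$2$1) (A$2$2)"
  by (simp add: vec_eq_iff forall_2)

lemma mat2_mult [simp]:
  "mat2 a b c d ** mat2 e f g h =
     mat2 (a * e + b * g) (a * f + b * h) (c * e + d * g) (c * f + d * h)"
  by (simp add: vec_eq_iff forall_2 matrix_matrix_mult_def sum_2)

lemma det_mat2 [simp]: "det (mat2 a b c d) = a * d - b * c"
  by (simp add: det_2)

lemma trace_mat2 [simp]: "trace (mat2 a b c d) = a + d"
  by (simp add: trace_def sum_2)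

lemma mat_1_eq_mat2: "mat 1 = mat2 1 0 0 1"
  by (simp add: vec_eq_iff forall_2 mat_def)

interpretation SL2Z: group SL2Z
  by (rule SL2Z_group)

lemma SL2Z_simps [simp]:
  "A \<in> carrier SL2Z \<longleftrightarrow> det A = 1" "A \<otimes>\<^bsub>SL2Z\<^esub> B = A ** B" "\<one>\<^bsub>SL2Z\<^esub> = mat 1"
  by (simp_all add: SL2Z_def)

lemma SL2Z_inv:
  assumes "det (mat2 a b c d) = 1"
  shows "inv\<^bsub>SL2Z\<^esub> (mat2 a b c d) = mat2 d (- b) (- c) a"
  using assms by (intro SL2Z.inv_equality) (auto simp: mat_1_eq_mat2 algebra_simps)

section \<open>The lattice spanned by 1, A, B, AB and its discriminant\<close>

definition span4 :: "int ^ 2 ^ 2 \<Rightarrow> int ^ 2 ^ 2 \<Rightarrow> (int ^ 2 ^ 2) set" where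
  "span4 A B = {M. \<exists>p q r s. \<forall>i j. M$i$j =
     p * (mat 1 :: int^2^2)$i$j + q * A$i$j + r * B$i$j + s * (A ** B)$i$j}"

lemma span4_mat2:
  "M \<in> span4 (mat2 a b c d) (mat2 e f g h) \<longleftrightarrow> (\<exists>p q r s.
     M = mat2 (p + q * a + r * e + s * (a * e + b * g)) (q * b + r * f + s * (a * f + b * h))
              (q * c + r * g + s * (c * e + d * g)) (p + q * d + r * h + s * (c * f + d * h)))"
  by (simp add: span4_def vec_eq_iff forall_2 mat_1_eq_mat2 conj_ac)

text \<open>By Cayley-Hamilton and its polarisation
  \<open>A ** B + B ** A = tr B A + tr A B + (tr (A ** B) - tr A tr B)\<close>.\<close>

lemma span4_mult_left:
  assumes "det A = 1" "det B = 1" "M \<in> span4 A B"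
  shows "A ** M \<in> span4 A B" "B ** M \<in> span4 A B"
    "inv\<^bsub>SL2Z\<^esub> A ** M \<in> span4 A B" "inv\<^bsub>SL2Z\<^esub> B ** M \<in> span4 A B"
proof -
  obtain a b c d where A: "A = mat2 a b c d" using mat2_eta by blast
  obtain e f g h where B: "B = mat2 e f g h" using mat2_eta by blast
  obtain p q r s where M: "M = mat2 (p + q * a + r * e + s * (a * e + b * g)) (q * b + r * f + s * (a * f + b * h))
              (q * c + r * g + s * (c * e + d * g)) (p + q * d + r * h + s * (c * f + d * h))"
    using assms(3) unfolding A B span4_mat2 by blast
  have inv: "inv\<^bsub>SL2Z\<^esub> A = mat2 d (- b) (- c) a" "inv\<^bsub>SL2Z\<^esub> B = mat2 h (- f) (- g) e"
    using assms A B SL2Z_inv by blast+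
  \<comment> \<open>\<open>?x\<close>, \<open>?y\<close>, \<open>?z\<close> are the traces of A, B,
    AB. With the determinants kept as \<open>?\<delta>\<close> and \<open>?\<epsilon>\<close>, every
    entry becomes a polynomial identity.\<close>
  let ?x = "a + d" and ?y = "e + h" and ?z = "a * e + b * g + c * f + d * h"
    and ?\<delta> = "a * d - b * c" and ?\<epsilon> = "e * h - f * g"
  have eqI: "mat2 a b c d = mat2 a' b' c' d'" if "a = a'" "b = b'" "c = c'" "d = d'" for a b c d a' b' c' d'
    using that by simp
  \<comment> \<open>The coefficients come from A^2 = \<open>?x\<close> A -
    \<open>?\<delta>\<close>.\<close>
  show "A ** M \<in> span4 A B"
    unfolding A B M span4_mat2 mat2_mult
    by (rule exI[of _ "- q * ?\<delta>"],
        rule exI[of _ "p + q * ?x"],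
        rule exI[of _ "- s * ?\<delta>"],
        rule exI[of _ "r + s * ?x"],
        rule eqI) (simp_all add: algebra_simps)
  \<comment> \<open>The polarised identity rewrites BA and yields BAB = \<open>?z\<close> B +
    \<open>?\<epsilon>\<close> A - \<open>?x * ?\<epsilon>\<close>.\<close>
  show "B ** M \<in> span4 A B"
    unfolding A B M span4_mat2 mat2_mult
    by (rule exI[of _ "q * (?z - ?x * ?y) - r * ?\<epsilon> - s * ?x * ?\<epsilon>"],
        rule exI[of _ "q * ?y + s * ?\<epsilon>"],
        rule exI[of _ "p + q * ?x + r * ?y + s * ?z"],
        rule exI[of _ "- q"],
        rule eqI) (simp_all add: algebra_simps)
  \<comment> \<open>The inverse is \<open>?x\<close> - A, so the coefficients are \<open>?x\<close>
    times those of M minus those of AM; likewise for B below.\<close>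
  show "inv\<^bsub>SL2Z\<^esub> A ** M \<in> span4 A B"
    unfolding inv unfolding A B M span4_mat2 mat2_mult
    by (rule exI[of _ "?x * p + q * ?\<delta>"],
        rule exI[of _ "- p"],
        rule exI[of _ "?x * r + s * ?\<delta>"],
        rule exI[of _ "- r"],
        rule eqI) (simp_all add: algebra_simps)
  show "inv\<^bsub>SL2Z\<^esub> B ** M \<in> span4 A B"
    unfolding inv unfolding A B M span4_mat2 mat2_mult
    by (rule exI[of _ "?y * p - q * (?z - ?x * ?y) + r * ?\<epsilon> + s * ?x * ?\<epsilon>"],
        rule exI[of _ "- s * ?\<epsilon>"],
        rule exI[of _ "- p - q * ?x - s * ?z"],
        rule exI[of _ "?y * s + q"],
        rule eqI) (simp_all add: algebra_simps)
qed

text \<open>Left multiplication by a word in the generators preserves the lattice; applied to the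
  identity matrix, it puts the word itself there.\<close>

lemma generate_subset_span4:
  assumes "det A = 1" "det B = 1"
  shows "generate SL2Z {A, B} \<subseteq> span4 A B"
proof
  fix g assume g: "g \<in> generate SL2Z {A, B}"
  have "g ** M \<in> span4 A B" if "M \<in> span4 A B" for M
    using g that
  proof (induction arbitrary: M rule: generate.induct)
    case (eng h1 h2)
    then show ?case by (simp flip: matrix_mul_assoc)
  qed (use span4_mult_left[OF assms] in auto)
  moreover have "mat 1 \<in> span4 A B"
    by (force simp: span4_def intro: exI[of _ 1] exI[of _ 0])
  ultimately show "g \<in> span4 A B" by force
qed

text \<open>The matrix \<open>D\<close> holds the coordinates of \<open>A\<close>, \<open>B\<close>, \<open>A ** B\<close> in the quotient of the integral
  matrices by the scalar ones.\<close>

lemma generating_pair_imp_markov: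
  assumes gen: "[A, B] \<in> generating_tuples SL2Z 2"
  shows "(trace A)^2 + (trace B)^2 + (trace (A ** B))^2 - trace A * trace B * trace (A ** B) \<in> {3, 5}"
proof -
  have det: "det A = 1" "det B = 1"
    using gen by (auto simp: generating_tuples_def)
  obtain a b c d where A: "A = mat2 a b c d" using mat2_eta by blast
  obtain e f g h where B: "B = mat2 e f g h" using mat2_eta by blast
  define D :: "int^3^3" where
    "D = vector [vector [a - d, b, c], vector [e - h, f, g],
       vector [a * e + b * g - (c * f + d * h), a * f + b * h, c * e + d * g]]"
  have carrier: "carrier SL2Z \<subseteq> span4 A B"
    using generate_subset_span4[OF det] gen by (simp add: generating_tuples_def)
  \<comment> \<open>The scalar coefficient \<open>p\<close> cancels in \<open>k - n\<close>, so
    \<open>q\<close>, \<open>r\<close>, \<open>s\<close> are integral coordinates modulo scalar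
    matrices.\<close>
  have coords: "\<exists>v :: int^3. v v* D = vector [k - n, l, m]"
    if "det (mat2 k l m n) = 1" for k l m n
  proof -
    have "mat2 k l m n \<in> span4 A B"
      using carrier that by auto
    then obtain p q r s where
      "mat2 k l m n = mat2 (p + q * a + r * e + s * (a * e + b * g)) (q * b + r * f + s * (a * f + b * h))
              (q * c + r * g + s * (c * e + d * g)) (p + q * d + r * h + s * (c * f + d * h))"
      unfolding A B span4_mat2 by blast
    then have "k = p + q * a + r * e + s * (a * e + b * g)" "l = q * b + r * f + s * (a * f + b * h)"
      "m = q * c + r * g + s * (c * e + d * g)" "n = p + q * d + r * h + s * (c * f + d * h)"
      by (metis mat2_nth)+
    then have "vector [q, r, s] v* D = vector [k - n, l, m]"
      by (simp add: vec_eq_iff forall_3 vector_matrix_mult_def sum_3 D_def algebra_simps)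
    then show ?thesis by blast
  qed
  \<comment> \<open>Three matrices of determinant one whose classes form a basis of the quotient; D
    therefore divides a unimodular matrix.\<close>
  obtain u v w where uvw: "u v* D = vector [0, 1, 0]" "v v* D = vector [0, 0, 1]" "w v* D = vector [1, 1, 1]"
    using coords[of 1 1 0 1] coords[of 1 0 1 1] coords[of 2 1 1 1] by auto
  define N :: "int^3^3" where "N = vector [u, v, w]"
  have "N ** D = vector [u v* D, v v* D, w v* D]"
    by (simp add: N_def vec_eq_iff forall_3 matrix_matrix_mult_def vector_matrix_mult_def sum_3 mult.commute)
  then have "det (N ** D) = 1"
    by (simp add: uvw det_3)
  then have "det D dvd 1"
    by (metis det_mul dvd_triv_right)
  then have "det D = 1 \<or> det D = -1" by auto
  \<comment> \<open>For A and B of determinant one the right side is, by Fricke's identity, tr[A,B]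
    - 2.\<close>
  moreover have "det D = (a + d)^2 * (e * h - f * g) + (e + h)^2 * (a * d - b * c) +
      (a * e + b * g + c * f + d * h)^2 - (a + d) * (e + h) * (a * e + b * g + c * f + d * h)
      - 4 * (a * d - b * c) * (e * h - f * g)"
    by (simp add: D_def det_3 power2_eq_square algebra_simps)
  moreover have "a * d - b * c = 1" "e * h - f * g = 1"
    using det by (simp_all add: A B)
  ultimately show ?thesis
    by (auto simp: A B add.assoc)
qed

section \<open>Nielsen reduction to an entry of trace zero\<close>

lemma trace_inv_SL2Z:
  assumes "det A = 1"
  shows "trace (inv\<^bsub>SL2Z\<^esub> A) = trace A"
proof -
  obtain a b c d where A: "A = mat2 a b c d" using mat2_eta by blast
  show ?thesis using SL2Z_inv[of a b c d] assms by (simp add: A)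
qed

text \<open>By Cayley-Hamilton the inverse of B is tr B - B. Inverting one entry thus realises the
  Markov move z -> xy - z.\<close>

lemma trace_mult_inv_SL2Z:
  assumes "det B = 1"
  shows "trace (A ** inv\<^bsub>SL2Z\<^esub> B) = trace A * trace B - trace (A ** B)"
proof -
  obtain a b c d where A: "A = mat2 a b c d" using mat2_eta by blast
  obtain e f g h where B: "B = mat2 e f g h" using mat2_eta by blast
  show ?thesis using SL2Z_inv[of e f g h] assms by (simp add: A B algebra_simps)
qed

lemma ex_least_int2:
  fixes m :: "'a \<Rightarrow> 'b \<Rightarrow> int"
  assumes "P a0 b0" "\<And>a b. 0 \<le> m a b"
  obtains a b where "P a b" "\<And>a' b'. P a' b' \<Longrightarrow> m a b \<le> m a' b'"
proof -
  obtain x where x: "case_prod P x" "\<And>y. case_prod P y \<Longrightarrow> nat (case_prod m x) \<le> nat (case_prod m y)"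
    using ex_has_least_nat[of "case_prod P" "(a0, b0)" "\<lambda>y. nat (case_prod m y)"] assms(1) by auto
  obtain a b where "x = (a, b)" by fastforce
  then show thesis
    using that[of a b] x(1) x(2)[of "(_, _)"] assms(2) by (simp add: nat_le_eq_zle)
qed

lemma nielsen_trace_zero:
  assumes gen: "[A0, B0] \<in> generating_tuples SL2Z 2"
  obtains A B where "nielsen_equivalent SL2Z [A0, B0] [A, B]" "trace A = 0"
proof -
  define \<mu> where "\<mu> A B = \<bar>trace A\<bar> + \<bar>trace B\<bar> + \<bar>trace (A ** B)\<bar>" for A B :: "int^2^2"
  define P where "P A B \<longleftrightarrow> nielsen_equivalent SL2Z [A0, B0] [A, B]" for A B
  have "P A0 B0"
    by (simp add: P_def SL2Z.nielsen_equivalent_refl)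
  then obtain A B where P: "P A B" and min: "\<And>A' B'. P A' B' \<Longrightarrow> \<mu> A B \<le> \<mu> A' B'"
    by (rule ex_least_int2[of P _ _ \<mu>]) (auto simp: \<mu>_def)
  have "[A, B] \<in> generating_tuples SL2Z 2"
    using P gen SL2Z.nielsen_equivalent_generating unfolding P_def by blast
  note markov = generating_pair_imp_markov[OF this]
  have det: "det A = 1" "det B = 1"
    using \<open>[A, B] \<in> generating_tuples SL2Z 2\<close> by (auto simp: generating_tuples_def)
  have P_swap: "P B' A'" if "P A' B'" for A' B'
    using that SL2Z.nielsen_equivalent_trans SL2Z.nielsen_swap unfolding P_def by blast
  have P_inv: "P A' (inv\<^bsub>SL2Z\<^esub> B')" if "P A' B'" for A' B'
    using that SL2Z.nielsen_equivalent_trans SL2Z.nielsen_inv2 unfolding P_def by blast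
  \<comment> \<open>This move permutes the traces: the new pair has traces x, z and its product has
    trace y. A following inversion then changes y instead of z; starting from the swapped pair, it
    changes x.\<close>
  have P_mult: "P (inv\<^bsub>SL2Z\<^esub> A') (A' ** B')" if "P A' B'" "det A' = 1" "det B' = 1" for A' B'
  proof -
    have "nielsen_equivalent SL2Z [A', B'] [inv\<^bsub>SL2Z\<^esub> A', A' ** B']"
      using SL2Z.nielsen_equivalent_trans[OF SL2Z.nielsen_mult2_left SL2Z.nielsen_inv1, of A' B'] that
      by simp
    then show ?thesis
      using that SL2Z.nielsen_equivalent_trans unfolding P_def by blast
  qed
  have inv_mult: "inv\<^bsub>SL2Z\<^esub> A' ** (A' ** B') = B'" if "det A' = 1" for A' B'
    using SL2Z.l_inv[of A'] that by (simp add: matrix_mul_assoc)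
  have comm: "trace (B ** A) = trace (A ** B)"
    by (rule trace_mul_sym)
  let ?x = "trace A" and ?y = "trace B" and ?z = "trace (A ** B)"
  have "\<bar>?z\<bar> \<le> \<bar>?x * ?y - ?z\<bar>"
    using min[OF P_inv[OF P]] det
    by (simp add: \<mu>_def trace_inv_SL2Z trace_mult_inv_SL2Z)
  moreover have "\<bar>?y\<bar> \<le> \<bar>?x * ?z - ?y\<bar>"
    using min[OF P_inv[OF P_mult[OF P det]]] det
    by (simp add: \<mu>_def trace_inv_SL2Z trace_mult_inv_SL2Z det_mul inv_mult)
  moreover have "\<bar>?x\<bar> \<le> \<bar>?y * ?z - ?x\<bar>"
    using min[OF P_inv[OF P_mult[OF P_swap[OF P] det(2,1)]]] det
    by (simp add: \<mu>_def trace_inv_SL2Z trace_mult_inv_SL2Z det_mul inv_mult comm)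
  ultimately have "?x = 0 \<or> ?y = 0 \<or> ?z = 0"
    using markov_minimal markov by blast
  \<comment> \<open>The entry of trace zero goes first; for z = 0 it is AB, in the pair formed by AB
    and the inverse of A.\<close>
  then show thesis
    using P P_swap[OF P] P_swap[OF P_mult[OF P det]] that unfolding P_def by blast
qed

section \<open>Reduction of the entry of trace zero by conjugation\<close>

lemma conj_trace_zero:
  assumes "trace A = 0" "det P = 1"
  shows "trace (P ** A ** inv\<^bsub>SL2Z\<^esub> P) = 0"
  using SL2Z.l_inv[of P] assms
  by (metis SL2Z_simps matrix_mul_assoc matrix_mul_lid trace_mul_sym)

lemma nielsen_trace_zero_reduced:
  assumes gen: "[A0, B0] \<in> generating_tuples SL2Z 2"
  obtains A B where "nielsen_equivalent SL2Z [A0, B0] [A, B]" "trace A = 0" "A$1$1 = 0"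
proof -
  define P where "P A B \<longleftrightarrow> nielsen_equivalent SL2Z [A0, B0] [A, B] \<and> trace A = 0" for A B
  obtain A1 B1 where "P A1 B1"
    using nielsen_trace_zero[OF gen] unfolding P_def by blast
  then obtain A B where P: "P A B" and min: "\<And>A' B'. P A' B' \<Longrightarrow> \<bar>A$1$1\<bar> \<le> \<bar>A'$1$1\<bar>"
    by (rule ex_least_int2[of P _ _ "\<lambda>A B. \<bar>A$1$1\<bar>"]) auto
  have AB: "[A, B] \<in> generating_tuples SL2Z 2"
    using P gen SL2Z.nielsen_equivalent_generating unfolding P_def by blast
  then have det: "det A = 1" "det B = 1" and generate: "generate SL2Z {A, B} = carrier SL2Z"
    by (auto simp: generating_tuples_def)
  \<comment> \<open>As the pair generates the whole group, conjugation by every T of determinant one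
    is a Nielsen equivalence.\<close>
  have conj: "\<bar>A$1$1\<bar> \<le> \<bar>(T ** A ** inv\<^bsub>SL2Z\<^esub> T)$1$1\<bar>" if "det T = 1" for T
  proof -
    have "nielsen_equivalent SL2Z [A, B] [T ** A ** inv\<^bsub>SL2Z\<^esub> T, T ** B ** inv\<^bsub>SL2Z\<^esub> T]"
      using SL2Z.nielsen_conj[of A B T] det that generate by simp
    then have "P (T ** A ** inv\<^bsub>SL2Z\<^esub> T) (T ** B ** inv\<^bsub>SL2Z\<^esub> T)"
      using P conj_trace_zero that SL2Z.nielsen_equivalent_trans unfolding P_def by blast
    then show ?thesis by (rule min)
  qed
  obtain a b c d where A: "A = mat2 a b c d" using mat2_eta by blast
  have d: "d = - a"
    using P by (simp add: P_def A)
  have bc: "a * a + b * c = - 1"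
    using det by (simp add: A d)
  \<comment> \<open>Upper shears turn the corner entry into a + c and a - c, lower ones into a - b
    and a + b. As b and c are nonzero, both are at least 2|a| in absolute value, against |bc| = a^2
    + 1.\<close>
  have "\<bar>a\<bar> \<le> \<bar>a + c\<bar>" "\<bar>a\<bar> \<le> \<bar>a - c\<bar>" "\<bar>a\<bar> \<le> \<bar>a + b\<bar>" "\<bar>a\<bar> \<le> \<bar>a - b\<bar>"
    using conj[of "mat2 1 1 0 1"] conj[of "mat2 1 (-1) 0 1"] conj[of "mat2 1 0 1 1"] conj[of "mat2 1 0 (-1) 1"]
    by (simp_all add: SL2Z_inv A)
  moreover have "b * c \<noteq> 0"
    using bc zero_le_square[of a] by linarith
  then have "b \<noteq> 0" "c \<noteq> 0" by auto
  ultimately have "2 * \<bar>a\<bar> \<le> \<bar>b\<bar>" "2 * \<bar>a\<bar> \<le> \<bar>c\<bar>" by linarith+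
  then have "(2 * \<bar>a\<bar>) * (2 * \<bar>a\<bar>) \<le> \<bar>b\<bar> * \<bar>c\<bar>"
    by (intro mult_mono) auto
  also have "\<dots> = a * a + 1"
    unfolding abs_mult[symmetric] using bc zero_le_square[of a] by linarith
  finally have "3 * (a * a) \<le> 1"
    by simp
  then have "a = 0"
    using zero_le_square[of a] mult_eq_0_iff[of a a] by linarith
  then show thesis
    using that[of A B] P by (auto simp: P_def A)
qed

section \<open>The finite set of representatives\<close>

text \<open>A finite box suffices as a cover, so neither determinant one nor generation is
  imposed.\<close>

definition small_pairs :: "(int ^ 2 ^ 2) list set" where
  "small_pairs = (\<lambda>(a, b, c, d, e, f, g, h). [mat2 a b c d, mat2 e f g h]) `
     ({-1..1} \<times> {-1..1} \<times> {-1..1} \<times> {-1..1} \<times> {-1..1} \<times> {-1..1} \<times> {-1..1} \<times> {-1..1})"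

lemma sum_squares_le_5:
  fixes x y :: int
  assumes "x^2 + y^2 \<le> 5"
  shows "\<bar>x\<bar> \<le> 2"
proof (rule ccontr)
  assume "\<not> ?thesis"
  then have "3^2 \<le> \<bar>x\<bar>^2" by (intro power_mono) auto
  then show False using assms zero_le_power2[of y] by simp
qed

lemma generating_pair_small:
  assumes gen: "[A, B] \<in> generating_tuples SL2Z 2" and "trace A = 0" "A$1$1 = 0"
  shows "[A, B] \<in> small_pairs"
proof -
  have det: "det A = 1" "det B = 1"
    using gen by (auto simp: generating_tuples_def)
  obtain a b c d where A: "A = mat2 a b c d" using mat2_eta by blast
  obtain e f g h where B: "B = mat2 e f g h" using mat2_eta by blast
  have ad: "a = 0" "d = 0"
    using assms by (auto simp: A)
  have "b * (- c) = 1" using det by (simp add: A ad)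
  then have bc: "b = 1 \<and> c = -1 \<or> b = -1 \<and> c = 1"
    using zmult_eq_1_iff[of b "- c"] by auto
  \<comment> \<open>Trace zero of A removes the product term of the Markov-type equation.\<close>
  have "(e + h)^2 + (b * g + c * f)^2 \<in> {3, 5}"
    using generating_pair_imp_markov[OF gen] by (simp add: A B ad)
  then have le: "(e + h)^2 + (g - f)^2 \<le> 5"
    using bc by (auto simp: power2_commute)
  have "e * h - f * g = 1" using det by (simp add: B)
  \<comment> \<open>The two sums of squares differ by 4 det B, so sums and differences of the
    entries are bounded together; parallel bounds 2 and 1 force each entry into {-1, 0, 1}.\<close>
  then have "(e - h)^2 + (g + f)^2 = (e + h)^2 + (g - f)^2 - 4"
    by (simp add: power2_eq_square algebra_simps)
  then have le1: "(e - h)^2 + (g + f)^2 \<le> 1"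
    using le by simp
  have "\<bar>e + h\<bar> \<le> 2" "\<bar>g - f\<bar> \<le> 2"
    using sum_squares_le_5[OF le] sum_squares_le_5[of "g - f" "e + h"] le by auto
  moreover have "\<bar>e - h\<bar> \<le> 1" "\<bar>g + f\<bar> \<le> 1"
    unfolding abs_square_le_1[symmetric]
    using le1 zero_le_power2[of "e - h"] zero_le_power2[of "g + f"] by linarith+
  ultimately have "e \<in> {-1..1}" "f \<in> {-1..1}" "g \<in> {-1..1}" "h \<in> {-1..1}"
    by auto
  then show ?thesis
    using bc unfolding small_pairs_def A B ad
    by (intro image_eqI[of _ _ "(0, b, c, 0, e, f, g, h)"]) auto
qed

lemma finite_small_pairs: "finite small_pairs"
  by (simp add: small_pairs_def)

lemma generating_pair_nielsen_small:
  assumes "xs \<in> generating_tuples SL2Z 2"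
  shows "\<exists>ys\<in>small_pairs. nielsen_equivalent SL2Z xs ys"
proof -
  obtain A0 B0 where xs: "xs = [A0, B0]"
    using assms by (auto simp: generating_tuples_def length_Suc_conv numeral_2_eq_2)
  obtain A B where "nielsen_equivalent SL2Z xs [A, B]" "trace A = 0" "A$1$1 = 0"
    using nielsen_trace_zero_reduced assms unfolding xs by blast
  then show ?thesis
    using generating_pair_small assms SL2Z.nielsen_equivalent_generating by blast
qed

theorem proposition1p3:
  fixes S :: "'a topology"
  shows "finite (nielsen_classes SL2Z 2) \<and>
    (S homeomorphic_space torus \<longrightarrow> mapping_class_group S \<cong> SL2Z \<longrightarrow>
       finite (nielsen_classes (mapping_class_group S) 2))"
proof (intro conjI impI)
  show "finite (nielsen_classes SL2Z 2)"
    using SL2Z.finite_nielsen_classes finite_small_pairs generating_pair_nielsen_small by blast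
next
  assume "mapping_class_group S \<cong> SL2Z"
  then have "SL2Z \<cong> mapping_class_group S"
    using group.iso_sym mapping_class_group_group by blast
  \<comment> \<open>The cover by \<open>small_pairs\<close> is carried along the isomorphism from
    \<open>SL2Z\<close>.\<close>
  then show "finite (nielsen_classes (mapping_class_group S) 2)"
    using finite_nielsen_cover_iso[OF SL2Z_group mapping_class_group_group] finite_small_pairs
      generating_pair_nielsen_small by blast
qed

end
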